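(* Let $\mathcal{X}=\mathbb{R}$. For every triple $(\delta,\gamma,p)$ such that $\delta\in(0,1/2)$, $2<\gamma<1+1/(2\delta)$ and $2\le p<\min\{4/\delta,\,2\gamma/(1+\gamma\delta)\}$, there exist random variables $X_i$ and $\xi_i$ satisfying (i) the pairs $(X_i,\xi_i)$ are i.i.d.; (ii) $\xi_i$ is not independent of $X_i$, but $\mathbb{E}[\xi_1\mid X_1]=0$ and $\|\xi_1\|_{p,1}<\infty$; and a sequence $\{\mathcal{F}_k\}_{k=1}^n$ of classes of functions defined on $\mathcal{X}$ with $\mathcal{F}_k\supset\mathcal{F}_n$ for every $1\le k\le n$, such that $$\mathbb{E}\sup_{f\in\mathcal{F}_k}\Big|\sum_{i=1}^k\epsilon_i f(X_i)\Big|\lesssim k^{1/\gamma}$$ holds for all $1\le k\le n$, and $$\mathbb{E}\sup_{f\in\mathcal{F}_n}\Big|\sum_{i=1}^n\xi_i f(X_i)\Big|\gtrsim_p \omega(n),$$ where $\omega(n)\ge n^{\beta}\cdot n^{\max\{1/\gamma,1/p\}}$ for some $\beta=\beta(\delta,\gamma,p)>0$. In other words, $\omega(n)$ grows faster than $n^{\max\{1/\gamma,1/p\}}$ (the order of the upper bound that holds when the $\xi_i$'s are independent of the $X_i$'s) by a positive power of $n$.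
   Context: $\epsilon_1,\epsilon_2,\ldots$ are i.i.d. Rademacher random variables independent of all other random variables. For a real random variable $\xi$ and $p\ge1$, $\|\xi\|_{p,1}=\int_0^\infty\mathbb{P}(|\xi|>t)^{1/p}\,dt$. $a\lesssim b$ means $a\le Cb$ for some absolute constant $C$, and $a\gtrsim_p b$ means $a\ge C_p b$ for a constant $C_p>0$ depending only on $p$. *)

theory Defs
  imports "HOL-Probability.Probability"
begin

definition iid_sequence :: "'a measure \<Rightarrow> 'b measure \<Rightarrow> (nat \<Rightarrow> 'a \<Rightarrow> 'b) \<Rightarrow> bool" where
  "iid_sequence M N Z \<longleftrightarrow>
     prob_space.indep_vars M (\<lambda>_. N) Z UNIV \<and>
     (\<forall>i. distr M N (Z i) = distr M N (Z 0))"

text \<open>Independence of two random elements with values in spaces of different types;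
  the library's \<^const>\<open>prob_space.indep_var\<close> requires a common type.\<close>

definition indep_pair ::
  "'a measure \<Rightarrow> 'b measure \<Rightarrow> ('a \<Rightarrow> 'b) \<Rightarrow> 'c measure \<Rightarrow> ('a \<Rightarrow> 'c) \<Rightarrow> bool" where
  "indep_pair M N Y N' Z \<longleftrightarrow>
     Y \<in> measurable M N \<and> Z \<in> measurable M N' \<and>
     prob_space.indep_set M {Y -` A \<inter> space M | A. A \<in> sets N} {Z -` B \<inter> space M | B. B \<in> sets N'}"

definition rademacher_sequence :: "'a measure \<Rightarrow> (nat \<Rightarrow> 'a \<Rightarrow> real) \<Rightarrow> bool" where
  "rademacher_sequence M eps \<longleftrightarrow>
     iid_sequence M borel eps \<and>
     (\<forall>i. measure M {w \<in> space M. eps i w = 1} = 1 / 2 \<and>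
          measure M {w \<in> space M. eps i w = - 1} = 1 / 2)"

text \<open>Valued in \<^typ>\<open>ennreal\<close>, so that finiteness is a genuine condition.\<close>

definition lorentz_norm_p1 :: "'a measure \<Rightarrow> real \<Rightarrow> ('a \<Rightarrow> real) \<Rightarrow> ennreal" where
  "lorentz_norm_p1 M p Y =
     (\<integral>\<^sup>+ t \<in> {0..}. ennreal (measure M {w \<in> space M. \<bar>Y w\<bar> > t} powr (1 / p)) \<partial>lborel)"

text \<open>\<open>E[Y | X] = 0\<close>, conditioning on the sigma-algebra generated by \<open>X\<close>.
  Integrability is required explicitly because \<^const>\<open>real_cond_exp\<close> is a total function.\<close>

definition cond_mean_zero :: "'a measure \<Rightarrow> ('a \<Rightarrow> real) \<Rightarrow> ('a \<Rightarrow> real) \<Rightarrow> bool" where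
  "cond_mean_zero M Y X \<longleftrightarrow>
     integrable M Y \<and>
     (AE w in M. real_cond_exp M (vimage_algebra (space M) X borel) Y w = 0)"

text \<open>The supremum of \<open>\<bar>W\<^sub>1 f(X\<^sub>1) + \<dots> + W\<^sub>k f(X\<^sub>k)\<bar>\<close> over \<open>f \<in> F\<close>; sequences are
  indexed from \<open>0\<close>. It lives in \<^typ>\<open>ennreal\<close> so that unbounded families get the value \<open>\<infinity>\<close>.\<close>

definition sup_process ::
  "(real \<Rightarrow> real) set \<Rightarrow> nat \<Rightarrow> (nat \<Rightarrow> 'a \<Rightarrow> real) \<Rightarrow> (nat \<Rightarrow> 'a \<Rightarrow> real) \<Rightarrow> 'a \<Rightarrow> ennreal" where
  "sup_process F k W X w = (SUP f\<in>F. ennreal \<bar>\<Sum>i<k. W i w * f (X i w)\<bar>)"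

end

theory Submission
  imports Defs
begin

text \<open>Let \<open>b = 1 / \<gamma>\<close>. The design points are uniform on \<open>(0, 1)\<close> and \<open>\<xi> = s * X powr -a\<close> with a fair sign \<open>s\<close>
  independent of \<open>X\<close>. Then \<open>E[\<xi> | X] = 0\<close>, while \<open>|\<xi>|\<close> is large precisely where \<open>X\<close> is small, and the norm
  \<open>\<parallel>\<xi>\<parallel>\<^sub>p\<^sub>,\<^sub>1\<close> is finite for \<open>0 < a < 1 / p\<close>.

  The function class lives on the region where the noise is large. For given \<open>n\<close> it consists of
  all \<open>\<plusminus>1\<close> step functions on a grid of \<open>2 n\<close> cells in the window \<open>(0, t]\<close> with \<open>t = n powr (b - 1)\<close>, and
  the same class is used for every \<open>k \<le> n\<close>.

  For Rademacher multipliers the supremum is at most the number of the first \<open>k\<close> points that fall into the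
  window, whose mean is \<open>k t \<le> k powr b\<close> because \<open>k \<le> n\<close>
  (\<open>nn_integral_sup_process_cell_class_le\<close>). For the multipliers \<open>\<xi>\<close> the grid is so fine that points
  seldom share a cell, and the signs of a step function can follow those of the noise. So the
  supremum is of the order of the sum of \<open>|\<xi>\<^sub>i|\<close> over the points in the window
  (\<open>nn_integral_sup_process_cell_class_ge\<close>), and there \<open>|\<xi>\<^sub>i| \<ge> t powr -a\<close>. Its expectation is therefore at
  least \<open>n t / 2 * t powr -a = n powr (b + a (1 - b)) / 2\<close>. Noise independent of
  \<open>X\<close> would be of its typical size there.

  It remains to choose \<open>a < 1 / p\<close> large enough for \<open>b + a (1 - b)\<close> to exceed both \<open>b\<close> and \<open>1 / p\<close>;
  \<open>a = (1 - b) / p\<close> works for \<open>p \<ge> 2\<close> (\<open>exponent_gain\<close>). The constants are \<open>C = 1\<close> and \<open>c = 1 / 2\<close>.\<close>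

section \<open>Sign patterns on a fine grid\<close>

definition cell :: "real \<Rightarrow> nat \<Rightarrow> real set" where
  "cell h c = {h * real c<..h * (real c + 1)}"

definition cell_signs :: "real \<Rightarrow> nat \<Rightarrow> nat set \<Rightarrow> real \<Rightarrow> real" where
  "cell_signs h K S x = (\<Sum>c<K. (if c \<in> S then 1 else - 1) * indicator (cell h c) x)"

text \<open>All \<open>\<plusminus>1\<close>-valued step functions on a grid of \<open>K\<close> half-open cells of length \<open>h\<close>, extended by \<open>0\<close>
  outside \<open>(0, h K]\<close>. The class shatters every set of points in distinct cells, and
  it is finite, so suprema over it are measurable.\<close>

definition cell_class :: "real \<Rightarrow> nat \<Rightarrow> (real \<Rightarrow> real) set" where
  "cell_class h K = cell_signs h K ` Pow {..<K}"

lemma sets_cell [measurable]: "cell h c \<in> sets borel"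
  by (simp add: cell_def)

lemma borel_measurable_cell_signs [measurable]: "cell_signs h K S \<in> borel_measurable borel"
  unfolding cell_signs_def by measurable

lemma finite_cell_class: "finite (cell_class h K)"
  by (simp add: cell_class_def)

lemma cell_class_measurable: "cell_class h K \<subseteq> borel_measurable borel"
  by (auto simp: cell_class_def)

lemma borel_measurable_sup_process [measurable (raw)]:
  assumes "countable F" "F \<subseteq> borel_measurable borel"
    and "\<And>i. W i \<in> borel_measurable M" "\<And>i. X i \<in> borel_measurable M"
  shows "sup_process F k W X \<in> borel_measurable M"
proof -
  have [measurable]: "f \<in> borel_measurable borel" if "f \<in> F" for f
    using assms(2) that by blast
  note [measurable] = assms(3,4)
  show ?thesis
    unfolding sup_process_def [abs_def] by (intro borel_measurable_SUP assms(1)) measurable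
qed

lemma sum_indicator_cell:
  assumes "0 \<le> h"
  shows "(\<Sum>c<K. indicator (cell h c) x :: real) = indicator {0<..h * real K} x"
proof (induction K)
  case (Suc K)
  have "0 \<le> h * real K"
    using assms by simp
  then have "x \<le> h * real K \<or> 0 < x"
    by linarith
  then show ?case
    unfolding sum.lessThan_Suc Suc.IH
    using assms by (auto simp: cell_def indicator_def algebra_simps)
qed (simp add: indicator_def)

lemma abs_cell_signs_le:
  assumes "0 \<le> h"
  shows "\<bar>cell_signs h K S x\<bar> \<le> indicator {0<..h * real K} x"
proof -
  have "\<bar>cell_signs h K S x\<bar> \<le> (\<Sum>c<K. \<bar>(if c \<in> S then 1 else - 1) * indicator (cell h c) x\<bar>)"
    unfolding cell_signs_def by (rule sum_abs)
  also have "\<dots> = (\<Sum>c<K. indicator (cell h c) x)"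
    by (intro sum.cong) (auto simp: abs_mult)
  finally show ?thesis
    by (simp add: sum_indicator_cell[OF assms])
qed

lemma sup_process_cell_class_le:
  assumes "0 \<le> h"
  shows "sup_process (cell_class h K) k W X w
    \<le> ennreal (\<Sum>i<k. \<bar>W i w\<bar> * indicator {0<..h * real K} (X i w))"
  unfolding sup_process_def
proof (intro SUP_least ennreal_leI)
  fix f assume "f \<in> cell_class h K"
  then have f: "\<bar>f x\<bar> \<le> indicator {0<..h * real K} x" for x
    using abs_cell_signs_le[OF assms] by (auto simp: cell_class_def)
  have "\<bar>\<Sum>i<k. W i w * f (X i w)\<bar> \<le> (\<Sum>i<k. \<bar>W i w * f (X i w)\<bar>)"
    by (rule sum_abs)
  also have "\<dots> \<le> (\<Sum>i<k. \<bar>W i w\<bar> * indicator {0<..h * real K} (X i w))"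
    unfolding abs_mult by (intro sum_mono mult_left_mono f) auto
  finally show "\<bar>\<Sum>i<k. W i w * f (X i w)\<bar> \<le> \<dots>" .
qed

text \<open>The signs can be chosen cell by cell to agree with the sign of the mass that the cell carries.\<close>

lemma sup_process_cell_class_ge:
  "ennreal (\<Sum>c<K. \<bar>\<Sum>i<k. W i w * indicator (cell h c) (X i w)\<bar>)
    \<le> sup_process (cell_class h K) k W X w"
proof -
  define D where "D c = (\<Sum>i<k. W i w * indicator (cell h c) (X i w))" for c
  define S where "S = {c. c < K \<and> 0 \<le> D c}"
  have "(\<Sum>i<k. W i w * cell_signs h K S (X i w))
      = (\<Sum>c<K. (if c \<in> S then 1 else - 1) * D c)"
    unfolding cell_signs_def D_def sum_distrib_left
    by (subst sum.swap) (simp add: mult_ac)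
  also have "\<dots> = (\<Sum>c<K. \<bar>D c\<bar>)"
    by (intro sum.cong) (auto simp: S_def)
  finally have eq: "\<bar>\<Sum>i<k. W i w * cell_signs h K S (X i w)\<bar> = (\<Sum>c<K. \<bar>D c\<bar>)"
    by (simp add: sum_nonneg)
  have "cell_signs h K S \<in> cell_class h K"
    by (auto simp: cell_class_def S_def)
  then have "ennreal \<bar>\<Sum>i<k. W i w * cell_signs h K S (X i w)\<bar> \<le> sup_process (cell_class h K) k W X w"
    unfolding sup_process_def by (rule SUP_upper)
  then show ?thesis
    unfolding eq D_def .
qed

text \<open>If at most one index lies in \<open>A\<close>, there is no collision and both sides are equal. If two or more do,
  each of them meets another one, so the left-hand side is at most \<open>0\<close>. In this form the
  lower bound involves only pairs of indices, hence only pairwise independence.\<close>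

lemma abs_sum_ge_sum_abs_minus_collisions:
  fixes D :: "'i \<Rightarrow> real"
  assumes "finite I"
  shows "(\<Sum>i\<in>I. \<bar>D i\<bar> * indicator A i)
      - (\<Sum>i\<in>I. \<Sum>j\<in>I - {i}. \<bar>D i\<bar> * indicator A i * indicator A j)
    \<le> \<bar>\<Sum>i\<in>I. D i * indicator A i\<bar>"
proof (cases "\<exists>i\<in>I. i \<in> A \<and> (I - {i}) \<inter> A = {}")
  case True
  then obtain i where i: "i \<in> I" "i \<in> A" "(I - {i}) \<inter> A = {}"
    by blast
  have single: "(\<Sum>j\<in>I. f j * indicator A j) = f i" for f :: "'i \<Rightarrow> real"
    using i assms by (subst sum.remove[of _ i]) (auto intro!: sum.neutral simp: indicator_def)
  show ?thesis
    unfolding single using assms by (auto intro!: sum_nonneg)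
next
  case False
  have "\<bar>D i\<bar> * indicator A i \<le> (\<Sum>j\<in>I - {i}. \<bar>D i\<bar> * indicator A i * indicator A j)"
    if i: "i \<in> I" for i
  proof (cases "i \<in> A")
    case True
    then obtain j where j: "j \<in> I - {i}" "j \<in> A"
      using False i by blast
    then have "\<bar>D i\<bar> * indicator A i = \<bar>D i\<bar> * indicator A i * indicator A j"
      by simp
    also have "\<dots> \<le> (\<Sum>j\<in>I - {i}. \<bar>D i\<bar> * indicator A i * indicator A j)"
      using j assms by (intro member_le_sum) auto
    finally show ?thesis .
  qed auto
  then have "(\<Sum>i\<in>I. \<bar>D i\<bar> * indicator A i)
      \<le> (\<Sum>i\<in>I. \<Sum>j\<in>I - {i}. \<bar>D i\<bar> * indicator A i * indicator A j)"
    by (rule sum_mono)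
  then show ?thesis
    by linarith
qed

section \<open>Expected suprema over sign patterns\<close>

lemma iid_sequence_expectation:
  fixes f :: "'b \<Rightarrow> real"
  assumes M: "prob_space M" and iid: "iid_sequence M N Z" and f: "f \<in> borel_measurable N"
  shows "(\<integral>w. f (Z i w) \<partial>M) = (\<integral>w. f (Z 0 w) \<partial>M)"
    and "integrable M (\<lambda>w. f (Z i w)) \<longleftrightarrow> integrable M (\<lambda>w. f (Z 0 w))"
proof -
  have Z: "Z j \<in> measurable M N" for j
    using iid unfolding iid_sequence_def prob_space.indep_vars_def2[OF M] by blast
  have d: "distr M N (Z i) = distr M N (Z 0)"
    using iid unfolding iid_sequence_def by metis
  show "(\<integral>w. f (Z i w) \<partial>M) = (\<integral>w. f (Z 0 w) \<partial>M)"
    using integral_distr[OF Z f] d by metis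
  show "integrable M (\<lambda>w. f (Z i w)) \<longleftrightarrow> integrable M (\<lambda>w. f (Z 0 w))"
    using integrable_distr_eq[OF Z f] d by metis
qed

lemma iid_sequence_expectation_mult:
  fixes f g :: "'b \<Rightarrow> real"
  assumes M: "prob_space M" and iid: "iid_sequence M N Z" and "i \<noteq> j"
    and f: "f \<in> borel_measurable N" and g: "g \<in> borel_measurable N"
    and int: "integrable M (\<lambda>w. f (Z 0 w))" "integrable M (\<lambda>w. g (Z 0 w))"
  shows "(\<integral>w. f (Z i w) * g (Z j w) \<partial>M) = (\<integral>w. f (Z 0 w) \<partial>M) * (\<integral>w. g (Z 0 w) \<partial>M)"
    and "integrable M (\<lambda>w. f (Z i w) * g (Z j w))"
proof -
  interpret prob_space M by (rule M)
  have "indep_vars (\<lambda>_. borel) (\<lambda>k w. (if k = i then f else g) (Z k w)) UNIV"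
  proof (rule indep_vars_compose2[where X = Z and Y = "\<lambda>k. if k = i then f else g"])
    show "indep_vars (\<lambda>_. N) Z UNIV"
      using iid by (simp add: iid_sequence_def)
  qed (use f g in simp)
  then have "indep_var (\<Pi>\<^sub>M k\<in>{i}. borel) (\<lambda>w. \<lambda>k\<in>{i}. (if k = i then f else g) (Z k w))
      (\<Pi>\<^sub>M k\<in>{j}. borel) (\<lambda>w. \<lambda>k\<in>{j}. (if k = i then f else g) (Z k w))"
    by (rule indep_var_restrict) (use \<open>i \<noteq> j\<close> in auto)
  then have "indep_var borel ((\<lambda>x. x i) \<circ> (\<lambda>w. \<lambda>k\<in>{i}. (if k = i then f else g) (Z k w)))
      borel ((\<lambda>x. x j) \<circ> (\<lambda>w. \<lambda>k\<in>{j}. (if k = i then f else g) (Z k w)))"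
    by (rule indep_var_compose) auto
  then have ind: "indep_var borel (\<lambda>w. f (Z i w)) borel (\<lambda>w. g (Z j w))"
    using \<open>i \<noteq> j\<close> by (simp add: comp_def)
  have int': "integrable M (\<lambda>w. f (Z i w))" "integrable M (\<lambda>w. g (Z j w))"
    using int iid_sequence_expectation(2)[OF M iid f, of i] iid_sequence_expectation(2)[OF M iid g, of j] by auto
  show "(\<integral>w. f (Z i w) * g (Z j w) \<partial>M) = (\<integral>w. f (Z 0 w) \<partial>M) * (\<integral>w. g (Z 0 w) \<partial>M)"
    using indep_var_lebesgue_integral[OF ind int'] iid_sequence_expectation(1)[OF M iid f, of i]
     iid_sequence_expectation(1)[OF M iid g, of j] by simp
  show "integrable M (\<lambda>w. f (Z i w) * g (Z j w))"
    using indep_var_integrable[OF ind int'] .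
qed

lemma nn_integral_sup_process_cell_class_le:
  assumes "prob_space M" and h: "0 \<le> h"
    and X: "\<And>i. X i \<in> borel_measurable M" and W: "\<And>i. W i \<in> borel_measurable M"
  shows "(\<integral>\<^sup>+ w. sup_process (cell_class h K) k W X w \<partial>M)
    \<le> (\<Sum>i<k. \<integral>\<^sup>+ w. ennreal (\<bar>W i w\<bar> * indicator {0<..h * real K} (X i w)) \<partial>M)"
proof -
  note [measurable] = X W
  have "(\<integral>\<^sup>+ w. sup_process (cell_class h K) k W X w \<partial>M)
      \<le> (\<integral>\<^sup>+ w. (\<Sum>i<k. ennreal (\<bar>W i w\<bar> * indicator {0<..h * real K} (X i w))) \<partial>M)"
    using sup_process_cell_class_le[OF h] by (intro nn_integral_mono) (simp add: sum_ennreal)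
  also have "\<dots> = (\<Sum>i<k. \<integral>\<^sup>+ w. ennreal (\<bar>W i w\<bar> * indicator {0<..h * real K} (X i w)) \<partial>M)"
    by (rule nn_integral_sum) measurable
  finally show ?thesis .
qed

text \<open>When a cell catches a given design point with probability at most \<open>1 / (2 n)\<close>, the \<open>n\<close> sample points
  rarely share a cell: by independence the collision terms of
  \<open>abs_sum_ge_sum_abs_minus_collisions\<close> cost at most half of the main term. So, up to a factor of
  \<open>2\<close>, the expected supremum recovers that of the full \<open>\<ell>\<^sup>1\<close> sum of the multipliers in the window \<open>(0, h K]\<close>, with no
  cancellation.\<close>

lemma nn_integral_sup_process_cell_class_ge:
  fixes X \<xi> :: "nat \<Rightarrow> 'a \<Rightarrow> real"
  assumes M: "prob_space M" and h: "0 \<le> h"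
    and iid: "iid_sequence M borel (\<lambda>i w. (X i w, \<xi> i w))"
    and int: "integrable M (\<xi> 0)"
    and sparse: "\<And>c. c < K \<Longrightarrow> real n * (\<integral>w. indicator (cell h c) (X 0 w) \<partial>M) \<le> 1 / 2"
  shows "ennreal (real n / 2 * (\<integral>w. \<bar>\<xi> 0 w\<bar> * indicator {0<..h * real K} (X 0 w) \<partial>M))
    \<le> (\<integral>\<^sup>+ w. sup_process (cell_class h K) n \<xi> X w \<partial>M)"
proof -
  interpret prob_space M by (rule M)
  have Z: "(\<lambda>w. (X i w, \<xi> i w)) \<in> M \<rightarrow>\<^sub>M borel" for i
    using iid unfolding iid_sequence_def indep_vars_def2 by blast
  have [measurable]: "X i \<in> borel_measurable M" "\<xi> i \<in> borel_measurable M" for i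
    using measurable_compose[OF Z[of i], of fst borel] measurable_compose[OF Z[of i], of snd borel]
    by (simp_all add: borel_prod[symmetric])
  define f where "f c z = \<bar>snd z\<bar> * indicator (cell h c) (fst z)" for c and z :: "real \<times> real"
  define g where "g c z = (indicator (cell h c) (fst z) :: real)" for c and z :: "real \<times> real"
  have fm: "f c \<in> borel_measurable borel" and gm: "g c \<in> borel_measurable borel" for c
    unfolding f_def g_def borel_prod[symmetric] by measurable
  define Z where "Z i w = (X i w, \<xi> i w)" for i w
  have iidZ: "iid_sequence M borel Z"
    using iid by (simp add: Z_def [abs_def])
  have fint: "integrable M (\<lambda>w. f c (Z 0 w))" for c
    using integrable_abs[OF int] by (rule Bochner_Integration.integrable_bound)
      (auto simp: f_def Z_def indicator_def)
  have gint: "integrable M (\<lambda>w. g c (Z 0 w))" for c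
    by (rule integrable_const_bound[of _ 1]) (auto simp: g_def Z_def indicator_def)
  have fint': "integrable M (\<lambda>w. f c (Z i w))" for c i
    using iid_sequence_expectation(2)[OF M iidZ fm] fint by blast
  define R where "R c w = (\<Sum>i<n. f c (Z i w)) - (\<Sum>i<n. \<Sum>j\<in>{..<n} - {i}. f c (Z i w) * g c (Z j w))"
    for c w
  define D where "D c w = \<bar>\<Sum>i<n. \<xi> i w * indicator (cell h c) (X i w)\<bar>" for c w
  have prod_int: "integrable M (\<lambda>w. f c (Z i w) * g c (Z j w))" if "j \<in> {..<n} - {i}" for c i j
    using that by (intro iid_sequence_expectation_mult(2)[OF M iidZ _ fm gm fint gint]) auto
  have R_int: "integrable M (R c)" for c
    unfolding R_def using fint' prod_int by (intro Bochner_Integration.integrable_diff Bochner_Integration.integrable_sum)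
  have D_int: "integrable M (D c)" for c
  proof (rule Bochner_Integration.integrable_bound)
    show "integrable M (\<lambda>w. \<Sum>i<n. f c (Z i w))"
      by (intro Bochner_Integration.integrable_sum fint')
    show "D c \<in> borel_measurable M"
      unfolding D_def by measurable
    show "AE w in M. norm (D c w) \<le> norm (\<Sum>i<n. f c (Z i w))"
    proof (rule AE_I2)
      fix w
      have "D c w \<le> (\<Sum>i<n. f c (Z i w))"
        unfolding D_def by (rule order_trans[OF sum_abs]) (simp add: f_def Z_def abs_mult)
      then show "norm (D c w) \<le> norm (\<Sum>i<n. f c (Z i w))"
        by (simp add: D_def)
    qed
  qed
  have R_le_D: "R c w \<le> D c w" for c w
    using abs_sum_ge_sum_abs_minus_collisions[of "{..<n}" "\<lambda>i. \<xi> i w" "{i. X i w \<in> cell h c}"]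
    by (simp add: R_def D_def f_def g_def Z_def indicator_def)
  have R_ge: "real n / 2 * (\<integral>w. f c (Z 0 w) \<partial>M) \<le> (\<integral>w. R c w \<partial>M)" if c: "c < K" for c
  proof -
    define a where "a = (\<integral>w. f c (Z 0 w) \<partial>M)"
    define b where "b = (\<integral>w. g c (Z 0 w) \<partial>M)"
    have "0 \<le> a" "0 \<le> b"
      by (auto simp: a_def b_def f_def g_def)
    have b: "real n * b \<le> 1 / 2"
      using sparse[OF c] by (simp add: b_def g_def Z_def)
    have eq: "(\<integral>w. f c (Z i w) \<partial>M) = a" for i
      unfolding a_def by (rule iid_sequence_expectation(1)[OF M iidZ fm])
    have eq2: "(\<integral>w. f c (Z i w) * g c (Z j w) \<partial>M) = a * b" if "j \<in> {..<n} - {i}" for i j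
      unfolding a_def b_def using that
      by (intro iid_sequence_expectation_mult(1)[OF M iidZ _ fm gm fint gint]) auto
    define T where "T = (\<Sum>i<n. \<Sum>j\<in>{..<n} - {i}. a * b)"
    have "(\<integral>w. R c w \<partial>M) = (\<Sum>i<n. a) - T"
    proof -
      have "(\<integral>w. (\<Sum>i<n. f c (Z i w)) \<partial>M) = (\<Sum>i<n. a)"
        by (subst Bochner_Integration.integral_sum) (use fint' eq in auto)
      moreover have "(\<integral>w. (\<Sum>i<n. \<Sum>j\<in>{..<n} - {i}. f c (Z i w) * g c (Z j w)) \<partial>M)
          = (\<Sum>i<n. \<Sum>j\<in>{..<n} - {i}. a * b)"
        by (simp only: Bochner_Integration.integral_sum Bochner_Integration.integrable_sum
            prod_int eq2 cong: sum.cong)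
      moreover have "integrable M (\<lambda>w. \<Sum>i<n. f c (Z i w))"
        "integrable M (\<lambda>w. \<Sum>i<n. \<Sum>j\<in>{..<n} - {i}. f c (Z i w) * g c (Z j w))"
        by (intro Bochner_Integration.integrable_sum fint' prod_int)+
      ultimately show ?thesis
        unfolding R_def T_def by (simp only: Bochner_Integration.integral_diff)
    qed
    moreover have "T \<le> (\<Sum>i<n. real n * (a * b))"
      unfolding T_def using \<open>0 \<le> a\<close> \<open>0 \<le> b\<close> by (intro sum_mono) (auto intro!: mult_right_mono)
    moreover have "(\<Sum>i<n. real n * (a * b)) = (real n * a) * (real n * b)"
      by simp
    moreover have "(real n * a) * (real n * b) \<le> (real n * a) * (1 / 2)"
      using b \<open>0 \<le> a\<close> by (intro mult_left_mono) auto
    moreover have "(\<Sum>i<n. a) = real n * a"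
      by simp
    ultimately have "real n * a - (real n * a) * (1 / 2) \<le> (\<integral>w. R c w \<partial>M)"
      by linarith
    then show ?thesis
      by (simp add: a_def [symmetric] mult.commute)
  qed
  have "real n / 2 * (\<integral>w. \<bar>\<xi> 0 w\<bar> * indicator {0<..h * real K} (X 0 w) \<partial>M)
      = real n / 2 * (\<integral>w. (\<Sum>c<K. f c (Z 0 w)) \<partial>M)"
    by (simp add: sum_indicator_cell[OF h, symmetric] f_def Z_def sum_distrib_left)
  also have "\<dots> = (\<Sum>c<K. real n / 2 * (\<integral>w. f c (Z 0 w) \<partial>M))"
    using fint by (simp add: sum_distrib_left)
  also have "\<dots> \<le> (\<Sum>c<K. (\<integral>w. R c w \<partial>M))"
    by (intro sum_mono R_ge) auto
  also have "\<dots> \<le> (\<Sum>c<K. (\<integral>w. D c w \<partial>M))"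
    by (intro sum_mono integral_mono R_int D_int R_le_D)
  also have "\<dots> = (\<integral>w. (\<Sum>c<K. D c w) \<partial>M)"
    using D_int by simp
  finally have "ennreal (real n / 2 * (\<integral>w. \<bar>\<xi> 0 w\<bar> * indicator {0<..h * real K} (X 0 w) \<partial>M))
      \<le> ennreal (\<integral>w. (\<Sum>c<K. D c w) \<partial>M)"
    by (rule ennreal_leI)
  also have "\<dots> = (\<integral>\<^sup>+ w. ennreal (\<Sum>c<K. D c w) \<partial>M)"
  proof (rule nn_integral_eq_integral[symmetric])
    show "integrable M (\<lambda>w. \<Sum>c<K. D c w)"
      by (intro Bochner_Integration.integrable_sum D_int)
  qed (simp add: D_def sum_nonneg)
  also have "\<dots> \<le> (\<integral>\<^sup>+ w. sup_process (cell_class h K) n \<xi> X w \<partial>M)"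
    unfolding D_def by (intro nn_integral_mono sup_process_cell_class_ge)
  finally show ?thesis .
qed

section \<open>Independent coordinates\<close>

lemma distr_PiM_coordinate:
  assumes "prob_space \<nu>"
  shows "distr (\<Pi>\<^sub>M i\<in>UNIV. \<nu>) \<nu> (\<lambda>w. w k) = \<nu>"
  by (rule distr_PiM_component) (use assms in auto)

lemma integral_PiM_coordinate:
  fixes \<phi> :: "'a \<Rightarrow> real"
  assumes "prob_space \<nu>" and \<phi>: "\<phi> \<in> borel_measurable \<nu>"
  shows "(\<integral>w. \<phi> (w k) \<partial>(\<Pi>\<^sub>M i\<in>UNIV. \<nu>)) = (\<integral>z. \<phi> z \<partial>\<nu>)"
    and "integrable (\<Pi>\<^sub>M i\<in>UNIV. \<nu>) (\<lambda>w. \<phi> (w k)) \<longleftrightarrow> integrable \<nu> \<phi>"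
proof -
  have m: "(\<lambda>w. w k) \<in> (\<Pi>\<^sub>M i\<in>UNIV. \<nu>) \<rightarrow>\<^sub>M \<nu>"
    by simp
  show "(\<integral>w. \<phi> (w k) \<partial>(\<Pi>\<^sub>M i\<in>UNIV. \<nu>)) = (\<integral>z. \<phi> z \<partial>\<nu>)"
    using integral_distr[OF m \<phi>] by (simp add: distr_PiM_coordinate assms(1))
  show "integrable (\<Pi>\<^sub>M i\<in>UNIV. \<nu>) (\<lambda>w. \<phi> (w k)) \<longleftrightarrow> integrable \<nu> \<phi>"
    using integrable_distr_eq[OF m \<phi>] by (simp add: distr_PiM_coordinate assms(1))
qed

lemma nn_integral_PiM_coordinate:
  assumes "prob_space \<nu>" and \<phi>: "\<phi> \<in> borel_measurable \<nu>"
  shows "(\<integral>\<^sup>+ w. \<phi> (w k) \<partial>(\<Pi>\<^sub>M i\<in>UNIV. \<nu>)) = (\<integral>\<^sup>+ z. \<phi> z \<partial>\<nu>)"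
  using nn_integral_distr[of "\<lambda>w. w k" "\<Pi>\<^sub>M i\<in>UNIV. \<nu>" \<nu> \<phi>] \<phi>
  by (simp add: distr_PiM_coordinate[OF assms(1)])

lemma indep_vars_PiM_coordinates:
  assumes \<nu>: "prob_space \<nu>"
  shows "prob_space.indep_vars (\<Pi>\<^sub>M i\<in>UNIV. \<nu>) (\<lambda>_. \<nu>) (\<lambda>i w. w i) (UNIV :: 'i set)"
proof -
  interpret prob_space "\<Pi>\<^sub>M i\<in>(UNIV :: 'i set). \<nu>"
    using \<nu> by (intro prob_space_PiM)
  have "distr (\<Pi>\<^sub>M i\<in>UNIV. \<nu>) \<nu> (\<lambda>w. w i) = \<nu>" for i :: 'i
    by (rule distr_PiM_coordinate[OF \<nu>])
  then show ?thesis
    by (subst indep_vars_iff_distr_eq_PiM) (auto simp: restrict_UNIV)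
qed

lemma iid_sequence_PiM_coordinates:
  fixes \<sigma> :: "nat \<Rightarrow> 'i"
  assumes \<nu>: "prob_space \<nu>" and "inj \<sigma>" and f: "f \<in> \<nu> \<rightarrow>\<^sub>M N"
  shows "iid_sequence (\<Pi>\<^sub>M i\<in>UNIV. \<nu>) N (\<lambda>j w. f (w (\<sigma> j)))"
proof -
  interpret prob_space "\<Pi>\<^sub>M i\<in>(UNIV :: 'i set). \<nu>"
    using \<nu> by (intro prob_space_PiM)
  have "indep_vars (\<lambda>j. \<Pi>\<^sub>M i\<in>{\<sigma> j}. \<nu>) (\<lambda>j w. restrict (\<lambda>i. w i) {\<sigma> j}) UNIV"
    using \<open>inj \<sigma>\<close>
    by (intro indep_vars_restrict[OF indep_vars_PiM_coordinates[OF \<nu>]])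
      (auto simp: disjoint_family_on_def inj_eq)
  then have "indep_vars (\<lambda>_. N) (\<lambda>j w. f (restrict (\<lambda>i. w i) {\<sigma> j} (\<sigma> j))) UNIV"
    by (rule indep_vars_compose2[where Y = "\<lambda>j x. f (x (\<sigma> j))"]) (use f in measurable)
  moreover have "distr (\<Pi>\<^sub>M i\<in>UNIV. \<nu>) N (\<lambda>w. f (w i)) = distr \<nu> N f" for i :: 'i
  proof -
    have "distr (\<Pi>\<^sub>M i\<in>UNIV. \<nu>) N (\<lambda>w. f (w i))
        = distr (distr (\<Pi>\<^sub>M i\<in>UNIV. \<nu>) \<nu> (\<lambda>w. w i)) N f"
      using f by (subst distr_distr) (auto simp: comp_def)
    then show ?thesis
      by (simp only: distr_PiM_coordinate[OF \<nu>])
  qed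
  ultimately show ?thesis
    by (simp add: iid_sequence_def)
qed

text \<open>A family that reads only the coordinates in \<open>range \<rho>\<close> generates no more events than the
  restriction to these coordinates. This reduces independence of two families with values in
  different types to independence of two restrictions with values in one type.\<close>

lemma coordinate_family_events:
  fixes \<rho> :: "'j \<Rightarrow> 'i"
  assumes u: "u \<in> \<nu> \<rightarrow>\<^sub>M L"
  shows "{(\<lambda>w j. u (w (\<rho> j))) -` B \<inter> space (\<Pi>\<^sub>M i\<in>UNIV. \<nu>) |B. B \<in> sets (\<Pi>\<^sub>M j\<in>UNIV. L)}
    \<subseteq> sigma_sets (space (\<Pi>\<^sub>M i\<in>UNIV. \<nu>))
        {(\<lambda>w. restrict w (range \<rho>)) -` A \<inter> space (\<Pi>\<^sub>M i\<in>UNIV. \<nu>) |A.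
          A \<in> sets (\<Pi>\<^sub>M i\<in>range \<rho>. \<nu>)}"
proof (intro subset_trans[OF _ sigma_sets_superset_generator] subsetI)
  fix D assume "D \<in> {(\<lambda>w j. u (w (\<rho> j))) -` B \<inter> space (\<Pi>\<^sub>M i\<in>UNIV. \<nu>) |B.
    B \<in> sets (\<Pi>\<^sub>M j\<in>UNIV. L)}"
  then obtain B where B: "B \<in> sets (\<Pi>\<^sub>M j\<in>(UNIV :: 'j set). L)"
    and D: "D = (\<lambda>w j. u (w (\<rho> j))) -` B \<inter> space (\<Pi>\<^sub>M i\<in>UNIV. \<nu>)"
    by blast
  have m: "(\<lambda>x j. u (x (\<rho> j))) \<in> (\<Pi>\<^sub>M i\<in>range \<rho>. \<nu>) \<rightarrow>\<^sub>M (\<Pi>\<^sub>M j\<in>(UNIV :: 'j set). L)"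
  proof (rule measurable_PiM_single')
    show "(\<lambda>x. u (x (\<rho> j))) \<in> (\<Pi>\<^sub>M i\<in>range \<rho>. \<nu>) \<rightarrow>\<^sub>M L" for j
      by (rule measurable_compose[where N = \<nu>, OF _ u]) (rule measurable_component_singleton, simp)
  qed (auto simp: space_PiM intro!: measurable_space[OF u])
  have "(\<lambda>w j. u (w (\<rho> j))) -` B \<inter> space (\<Pi>\<^sub>M i\<in>UNIV. \<nu>)
      = (\<lambda>w. restrict w (range \<rho>)) -`
        ((\<lambda>x j. u (x (\<rho> j))) -` B \<inter> space (\<Pi>\<^sub>M i\<in>range \<rho>. \<nu>)) \<inter> space (\<Pi>\<^sub>M i\<in>UNIV. \<nu>)"
    by (auto simp: space_PiM PiE_iff)
  then show "D \<in> {(\<lambda>w. restrict w (range \<rho>)) -` A \<inter> space (\<Pi>\<^sub>M i\<in>UNIV. \<nu>) |A.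
      A \<in> sets (\<Pi>\<^sub>M i\<in>range \<rho>. \<nu>)}"
    unfolding D
    using measurable_sets[OF m B] by blast
qed

lemma coordinate_family_measurable:
  assumes u: "u \<in> \<nu> \<rightarrow>\<^sub>M L"
  shows "(\<lambda>w j. u (w (\<rho> j))) \<in> (\<Pi>\<^sub>M i\<in>UNIV. \<nu>) \<rightarrow>\<^sub>M (\<Pi>\<^sub>M j\<in>UNIV. L)"
proof (rule measurable_PiM_single')
  show "(\<lambda>x. u (x (\<rho> j))) \<in> (\<Pi>\<^sub>M i\<in>UNIV. \<nu>) \<rightarrow>\<^sub>M L" for j
    by (rule measurable_compose[where N = \<nu>, OF _ u]) (rule measurable_component_singleton, simp)
qed (auto simp: space_PiM intro!: measurable_space[OF u])

lemma indep_pair_PiM_disjoint_coordinates: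
  assumes \<nu>: "prob_space \<nu>" and disj: "range \<sigma> \<inter> range \<tau> = {}"
    and f: "f \<in> \<nu> \<rightarrow>\<^sub>M N" and g: "g \<in> \<nu> \<rightarrow>\<^sub>M N'"
  shows "indep_pair (\<Pi>\<^sub>M i\<in>UNIV. \<nu>)
    (\<Pi>\<^sub>M j\<in>UNIV. N) (\<lambda>w j. f (w (\<sigma> j))) (\<Pi>\<^sub>M j\<in>UNIV. N') (\<lambda>w j. g (w (\<tau> j)))"
proof -
  let ?M = "\<Pi>\<^sub>M i\<in>UNIV. \<nu>"
  interpret prob_space ?M
    using \<nu> by (intro prob_space_PiM)
  have ind: "indep_var (\<Pi>\<^sub>M i\<in>range \<sigma>. \<nu>) (\<lambda>w. restrict (\<lambda>i. w i) (range \<sigma>))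
      (\<Pi>\<^sub>M i\<in>range \<tau>. \<nu>) (\<lambda>w. restrict (\<lambda>i. w i) (range \<tau>))"
    using disj by (intro indep_var_restrict[OF indep_vars_PiM_coordinates[OF \<nu>]]) auto
  have "indep_set {(\<lambda>w j. f (w (\<sigma> j))) -` B \<inter> space ?M |B. B \<in> sets (\<Pi>\<^sub>M j\<in>UNIV. N)}
      {(\<lambda>w j. g (w (\<tau> j))) -` B \<inter> space ?M |B. B \<in> sets (\<Pi>\<^sub>M j\<in>UNIV. N')}"
    using ind unfolding indep_var_eq indep_set_def
  proof (elim conjE indep_sets_mono_sets)
    fix b :: bool
    show "(case b of
          True \<Rightarrow> {(\<lambda>w j. f (w (\<sigma> j))) -` B \<inter> space ?M |B. B \<in> sets (\<Pi>\<^sub>M j\<in>UNIV. N)}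
        | False \<Rightarrow> {(\<lambda>w j. g (w (\<tau> j))) -` B \<inter> space ?M |B. B \<in> sets (\<Pi>\<^sub>M j\<in>UNIV. N')})
      \<subseteq> (case b of
          True \<Rightarrow> sigma_sets (space ?M) {(\<lambda>w. restrict w (range \<sigma>)) -` A \<inter> space ?M |A.
            A \<in> sets (\<Pi>\<^sub>M i\<in>range \<sigma>. \<nu>)}
        | False \<Rightarrow> sigma_sets (space ?M) {(\<lambda>w. restrict w (range \<tau>)) -` A \<inter> space ?M |A.
            A \<in> sets (\<Pi>\<^sub>M i\<in>range \<tau>. \<nu>)})"
      using coordinate_family_events[OF f, of \<sigma>] coordinate_family_events[OF g, of \<tau>]
      by (cases b) simp_all
  qed
  then show ?thesis
    by (simp add: indep_pair_def coordinate_family_measurable f g)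
qed

lemma cond_mean_zeroI:
  assumes M: "prob_space M" and X: "X \<in> borel_measurable M" and Y: "integrable M Y"
    and orth: "\<And>B. B \<in> sets borel \<Longrightarrow> (\<integral>w. indicator B (X w) * Y w \<partial>M) = 0"
  shows "cond_mean_zero M Y X"
proof -
  let ?F = "vimage_algebra (space M) X borel"
  interpret prob_space M by (rule M)
  interpret finite_measure_subalgebra M ?F
    using X by unfold_locales (simp add: subalgebra_def measurable_iff_sets)
  have "AE w in M. real_cond_exp M ?F Y w = 0"
  proof (rule real_cond_exp_charact)
    fix A assume "A \<in> sets ?F"
    then obtain B where B: "B \<in> sets borel" "A = X -` B \<inter> space M"
      by (auto simp: sets_vimage_algebra2)
    have "(\<integral>w\<in>A. Y w \<partial>M) = (\<integral>w. indicator B (X w) * Y w \<partial>M)"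
      unfolding set_lebesgue_integral_def B(2)
      by (intro Bochner_Integration.integral_cong) (auto simp: indicator_def)
    then show "(\<integral>w\<in>A. Y w \<partial>M) = (\<integral>w\<in>A. 0 \<partial>M)"
      by (simp add: orth[OF B(1)])
  qed (use Y in auto)
  then show ?thesis
    using Y by (simp add: cond_mean_zero_def)
qed

section \<open>Noise with a power singularity in the design point\<close>

definition unit_interval :: "real measure" where
  "unit_interval = restrict_space lborel {0<..<1}"

text \<open>A fair sign, stored as the pair \<open>(\<plusminus>1, 0)\<close> so that together with a real design point it forms a
  triple of reals.\<close>

definition random_sign :: "(real \<times> real) measure" where
  "random_sign = uniform_count_measure {(1, 0), (-1, 0)}"

definition sample :: "(real \<times> real \<times> real) measure" where
  "sample = unit_interval \<Otimes>\<^sub>M random_sign"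

lemma prob_space_unit_interval: "prob_space unit_interval"
  unfolding unit_interval_def by (rule prob_space_restrict_space) auto

lemma prob_space_random_sign: "prob_space random_sign"
  unfolding random_sign_def by (rule prob_space_uniform_count_measure) auto

lemma prob_space_sample: "prob_space sample"
  unfolding sample_def by (intro prob_space_pair prob_space_unit_interval prob_space_random_sign)

lemma space_sample: "space sample = {0<..<1} \<times> {(1, 0), (-1, 0)}"
  by (simp add: sample_def unit_interval_def random_sign_def space_pair_measure
      space_restrict_space space_uniform_count_measure)

lemma measurable_fst_sample [measurable]: "fst \<in> borel_measurable sample"
proof -
  have "fst \<in> sample \<rightarrow>\<^sub>M unit_interval"
    unfolding sample_def by measurable
  moreover have "id \<in> unit_interval \<rightarrow>\<^sub>M borel"
    unfolding unit_interval_def by (intro measurable_restrict_space1) simp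
  ultimately have "id \<circ> fst \<in> borel_measurable sample"
    by (rule measurable_comp)
  then show ?thesis
    by simp
qed

lemma measurable_sign_sample [measurable]: "(\<lambda>z. fst (snd z)) \<in> borel_measurable sample"
proof -
  have "snd \<in> sample \<rightarrow>\<^sub>M random_sign"
    unfolding sample_def by measurable
  moreover have "fst \<in> borel_measurable random_sign"
    by (simp add: random_sign_def measurable_def space_uniform_count_measure
        sets_uniform_count_measure Int_lower2)
  ultimately show ?thesis
    by (rule measurable_compose)
qed

lemma distr_fst_sample: "distr sample unit_interval fst = unit_interval"
  unfolding sample_def by (rule prob_space.distr_pair_fst[OF prob_space_random_sign])

lemma nn_integral_fst_sample:
  assumes \<phi> [measurable]: "\<phi> \<in> borel_measurable borel"
  shows "(\<integral>\<^sup>+ z. \<phi> (fst z) \<partial>sample) = (\<integral>\<^sup>+ x. \<phi> x * indicator {0<..<1} x \<partial>lborel)"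
proof -
  have m: "\<phi> \<in> borel_measurable unit_interval"
    unfolding unit_interval_def by (intro measurable_restrict_space1) measurable
  have "(\<integral>\<^sup>+ z. \<phi> (fst z) \<partial>sample) = (\<integral>\<^sup>+ x. \<phi> x \<partial>distr sample unit_interval fst)"
    using m by (subst nn_integral_distr) (auto simp: sample_def)
  also have "\<dots> = (\<integral>\<^sup>+ x. \<phi> x * indicator {0<..<1} x \<partial>lborel)"
    unfolding distr_fst_sample unfolding unit_interval_def
    by (rule nn_integral_restrict_space) simp
  finally show ?thesis .
qed

text \<open>Integrating out the sign first kills every function of the form sign times function of
  the design point. This is the source of the conditional centering of the noise.\<close>

lemma integral_sign_sample:
  fixes \<phi> :: "real \<Rightarrow> real"
  assumes int: "integrable sample (\<lambda>z. fst (snd z) * \<phi> (fst z))"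
  shows "(\<integral>z. fst (snd z) * \<phi> (fst z) \<partial>sample) = 0"
proof -
  interpret U: prob_space unit_interval by (rule prob_space_unit_interval)
  interpret V: prob_space random_sign by (rule prob_space_random_sign)
  interpret UV: pair_sigma_finite unit_interval random_sign ..
  have "(\<integral>z. fst (snd z) * \<phi> (fst z) \<partial>sample)
      = (\<integral>x. (\<integral>y. fst y * \<phi> x \<partial>random_sign) \<partial>unit_interval)"
    using UV.integral_fst'[OF int[unfolded sample_def]] by (simp add: sample_def)
  also have "(\<lambda>x. \<integral>y. fst y * \<phi> x \<partial>random_sign) = (\<lambda>x. 0)"
    by (simp add: random_sign_def integral_uniform_count_measure)
  finally show ?thesis
    by simp
qed

lemma measure_sign_sample:
  assumes "s \<in> {1, -1}"
  shows "measure sample {z \<in> space sample. fst (snd z) = s} = 1 / 2"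
proof -
  interpret U: prob_space unit_interval by (rule prob_space_unit_interval)
  interpret V: prob_space random_sign by (rule prob_space_random_sign)
  have "{z \<in> space sample. fst (snd z) = s} = space unit_interval \<times> {(s, 0)}"
    using assms by (auto simp: space_sample unit_interval_def space_restrict_space)
  moreover have "emeasure random_sign {(s, 0)} = ennreal (1 / 2)"
    using assms unfolding random_sign_def
    by (subst emeasure_uniform_count_measure) auto
  moreover have "{(s, 0)} \<in> sets random_sign"
    using assms by (auto simp: random_sign_def sets_uniform_count_measure)
  ultimately have "emeasure sample {z \<in> space sample. fst (snd z) = s} = ennreal (1 / 2)"
    by (simp add: sample_def V.emeasure_pair_measure_Times U.emeasure_space_1 del: ennreal_half)
  then show ?thesis
    unfolding measure_def by (simp only: enn2real_ennreal)
qed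

lemma rademacher_sequence_sample:
  fixes \<sigma> :: "nat \<Rightarrow> 'i"
  assumes "inj \<sigma>"
  shows "rademacher_sequence (\<Pi>\<^sub>M i\<in>UNIV. sample) (\<lambda>i w. fst (snd (w (\<sigma> i))))"
proof -
  have half: "measure (\<Pi>\<^sub>M i\<in>UNIV. sample) {w \<in> space (\<Pi>\<^sub>M i\<in>UNIV. sample). fst (snd (w k)) = s} = 1 / 2"
    if "s \<in> {1, -1}" for s :: real and k :: 'i
  proof -
    have "measure (distr (\<Pi>\<^sub>M i\<in>UNIV. sample) sample (\<lambda>w. w k)) {z \<in> space sample. fst (snd z) = s}
        = measure (\<Pi>\<^sub>M i\<in>UNIV. sample)
          ((\<lambda>w. w k) -` {z \<in> space sample. fst (snd z) = s} \<inter> space (\<Pi>\<^sub>M i\<in>UNIV. sample))"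
      by (rule measure_distr) measurable
    also have "(\<lambda>w. w k) -` {z \<in> space sample. fst (snd z) = s} \<inter> space (\<Pi>\<^sub>M i\<in>UNIV. sample)
        = {w \<in> space (\<Pi>\<^sub>M i\<in>UNIV. sample). fst (snd (w k)) = s}"
      by (auto simp: space_PiM)
    finally show ?thesis
      using measure_sign_sample[OF that] by (simp add: distr_PiM_coordinate[OF prob_space_sample])
  qed
  show ?thesis
    unfolding rademacher_sequence_def
  proof (intro conjI allI)
    show "iid_sequence (\<Pi>\<^sub>M i\<in>UNIV. sample) borel (\<lambda>i w. fst (snd (w (\<sigma> i))))"
      by (rule iid_sequence_PiM_coordinates[OF prob_space_sample assms measurable_sign_sample])
  qed (rule half; simp)+
qed

lemma nn_integral_powr_from_0:
  assumes "a < 1"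
  shows "(\<integral>\<^sup>+ x. ennreal (x powr - a) * indicator {0<..<1} x \<partial>lborel) < \<infinity>"
proof -
  have "((\<lambda>x. x powr - a) has_integral (1 powr (- a + 1) / (- a + 1))) {0..1::real}"
    using assms by (intro has_integral_powr_from_0) auto
  from nn_integral_has_integral_lebesgue[OF _ this]
  have fin: "(\<integral>\<^sup>+ x. ennreal (indicator {0..1} x * x powr - a) \<partial>lborel) < \<infinity>"
    by simp
  have "(\<integral>\<^sup>+ x. ennreal (x powr - a) * indicator {0<..<1} x \<partial>lborel)
      \<le> (\<integral>\<^sup>+ x. ennreal (indicator {0..1} x * x powr - a) \<partial>lborel)"
    by (intro nn_integral_mono) (auto simp: indicator_def)
  then show ?thesis
    using fin by (rule le_less_trans)
qed

lemma integral_indicator_fst_sample: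
  assumes B [measurable]: "B \<in> sets borel"
  shows "(\<integral>z. indicator B (fst z) \<partial>sample) = measure lborel (B \<inter> {0<..<1})"
    and "(\<integral>\<^sup>+ z. indicator B (fst z) \<partial>sample) = emeasure lborel (B \<inter> {0<..<1})"
proof -
  have "(\<integral>\<^sup>+ z. indicator B (fst z) \<partial>sample) = (\<integral>\<^sup>+ x. indicator B x * indicator {0<..<1} x \<partial>lborel)"
    by (rule nn_integral_fst_sample) measurable
  also have "\<dots> = emeasure lborel (B \<inter> {0<..<1})"
    by (simp flip: indicator_inter_arith)
  finally show *: "(\<integral>\<^sup>+ z. indicator B (fst z) \<partial>sample) = emeasure lborel (B \<inter> {0<..<1})" .
  have "(\<integral>z. indicator B (fst z) \<partial>sample) = enn2real (\<integral>\<^sup>+ z. ennreal (indicator B (fst z)) \<partial>sample)"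
    by (rule integral_eq_nn_integral) auto
  then show "(\<integral>z. indicator B (fst z) \<partial>sample) = measure lborel (B \<inter> {0<..<1})"
    by (simp add: ennreal_indicator * measure_def)
qed

lemma measure_fst_sample:
  assumes B [measurable]: "B \<in> sets borel"
  shows "measure sample {z \<in> space sample. fst z \<in> B} = measure lborel (B \<inter> {0<..<1})"
proof -
  have "measure sample {z \<in> space sample. fst z \<in> B} = (\<integral>z. indicator {z \<in> space sample. fst z \<in> B} z \<partial>sample)"
    by simp
  also have "\<dots> = (\<integral>z. indicator B (fst z) \<partial>sample)"
    by (intro Bochner_Integration.integral_cong) (auto simp: indicator_def)
  finally show ?thesis
    by (simp add: integral_indicator_fst_sample)
qed

text \<open>The symmetric noise attached to a design point \<open>x\<close>: for \<open>a > 0\<close> its absolute value \<open>x powr -a\<close> is a function of \<open>x\<close>, and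
  it is largest near \<open>0\<close>. The tail is \<open>P(|noise| > s) \<le> s powr (-1/a)\<close>, so the condition \<open>a p < 1\<close> makes its
  \<open>L\<^sub>p\<^sub>,\<^sub>1\<close> norm finite.\<close>

definition noise :: "real \<Rightarrow> real \<times> real \<times> real \<Rightarrow> real" where
  "noise a z = fst (snd z) * fst z powr - a"

lemma borel_measurable_noise [measurable]: "noise a \<in> borel_measurable sample"
  unfolding noise_def by measurable

lemma abs_noise: "z \<in> space sample \<Longrightarrow> \<bar>noise a z\<bar> = fst z powr - a"
  by (auto simp: noise_def space_sample abs_mult)

lemma integrable_noise:
  assumes "a < 1"
  shows "integrable sample (noise a)"
proof (rule integrableI_bounded)
  have "(\<integral>\<^sup>+ z. ennreal (norm (noise a z)) \<partial>sample) = (\<integral>\<^sup>+ z. ennreal (fst z powr - a) \<partial>sample)"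
    by (intro nn_integral_cong) (simp add: abs_noise)
  also have "\<dots> = (\<integral>\<^sup>+ x. ennreal (x powr - a) * indicator {0<..<1} x \<partial>lborel)"
    by (rule nn_integral_fst_sample) measurable
  also have "\<dots> < \<infinity>"
    by (rule nn_integral_powr_from_0[OF assms])
  finally show "(\<integral>\<^sup>+ z. ennreal (norm (noise a z)) \<partial>sample) < \<infinity>" .
qed measurable

lemma integral_abs_noise_ge:
  assumes "0 \<le> a" "a < 1" "0 < t" "t \<le> 1"
  shows "t powr (1 - a) \<le> (\<integral>z. \<bar>noise a z\<bar> * indicator {0<..t} (fst z) \<partial>sample)"
proof -
  interpret prob_space sample by (rule prob_space_sample)
  have "measure lborel ({0<..t} \<inter> {0<..<1}) = t"
  proof (cases "t = 1")
    case True
    then have "{0<..t} \<inter> {0<..<1} = {0<..<t}"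
      by auto
    then show ?thesis
      using assms by simp
  next
    case False
    then have "{0<..t} \<inter> {0<..<1} = {0<..t}"
      using assms by auto
    then show ?thesis
      using assms by simp
  qed
  then have "t powr (1 - a) = (\<integral>z. t powr - a * indicator {0<..t} (fst z) \<partial>sample)"
    using assms by (simp add: integral_indicator_fst_sample powr_diff powr_minus divide_simps)
  also have "\<dots> \<le> (\<integral>z. \<bar>noise a z\<bar> * indicator {0<..t} (fst z) \<partial>sample)"
  proof (rule integral_mono)
    show "integrable sample (\<lambda>z. t powr - a * indicator {0<..t} (fst z))"
      by (rule integrable_const_bound[of _ "t powr - a"]) (auto simp: indicator_def)
    show "integrable sample (\<lambda>z. \<bar>noise a z\<bar> * indicator {0<..t} (fst z))"
      using integrable_abs[OF integrable_noise[OF \<open>a < 1\<close>]]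
      by (rule Bochner_Integration.integrable_bound) (auto simp: indicator_def)
    fix z assume z: "z \<in> space sample"
    show "t powr - a * indicator {0<..t} (fst z) \<le> \<bar>noise a z\<bar> * indicator {0<..t} (fst z)"
      unfolding abs_noise[OF z] using assms by (auto simp: indicator_def intro!: powr_mono2')
  qed
  finally show ?thesis .
qed

lemma measure_noise_tail_le:
  assumes "0 < a" "0 < s"
  shows "measure sample {z \<in> space sample. s < \<bar>noise a z\<bar>} \<le> s powr - (1 / a)"
proof -
  interpret prob_space sample by (rule prob_space_sample)
  have "fst z \<in> {..s powr - (1 / a)}" if "z \<in> space sample" "s < \<bar>noise a z\<bar>" for z
  proof -
    have pos: "0 < fst z"
      using that by (auto simp: space_sample)
    have "(fst z powr - a) powr - (1 / a) \<le> s powr - (1 / a)"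
      using that assms by (intro powr_mono2') (auto simp: abs_noise)
    then show ?thesis
      using pos assms by (simp add: powr_powr)
  qed
  then have "measure sample {z \<in> space sample. s < \<bar>noise a z\<bar>}
      \<le> measure sample {z \<in> space sample. fst z \<in> {..s powr - (1 / a)}}"
    by (intro finite_measure_mono) auto
  also have "\<dots> = measure lborel ({..s powr - (1 / a)} \<inter> {0<..<1})"
    by (rule measure_fst_sample) simp
  also have "\<dots> \<le> measure lborel {0<..s powr - (1 / a)}"
    by (intro measure_mono_fmeasurable) (auto simp: fmeasurable_def)
  also have "\<dots> = s powr - (1 / a)"
    by simp
  finally show ?thesis .
qed

lemma lorentz_norm_p1_noise:
  assumes "0 < a" "0 < p" "a * p < 1"
  shows "(\<integral>\<^sup>+ s\<in>{0..}. ennreal (measure sample {z \<in> space sample. \<bar>noise a z\<bar> > s} powr (1 / p)) \<partial>lborel) < \<infinity>"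
proof -
  interpret prob_space sample by (rule prob_space_sample)
  define r where "r = - (1 / (a * p))"
  have r: "r < -1"
    using assms by (simp add: r_def field_simps)
  have bound: "ennreal (measure sample {z \<in> space sample. \<bar>noise a z\<bar> > s} powr (1 / p)) * indicator {0..} s
      \<le> indicator {0..<1} s + ennreal (indicator {1..} s * s powr r)" for s
  proof (cases "s < 1")
    case True
    have "measure sample {z \<in> space sample. \<bar>noise a z\<bar> > s} powr (1 / p) \<le> 1 powr (1 / p)"
      using assms by (intro powr_mono2) auto
    then have "ennreal (measure sample {z \<in> space sample. \<bar>noise a z\<bar> > s} powr (1 / p)) \<le> 1"
      by (simp add: ennreal_le_1)
    then show ?thesis
      using True by (auto simp: indicator_def)
  next
    case False
    have "measure sample {z \<in> space sample. \<bar>noise a z\<bar> > s} powr (1 / p) \<le> (s powr - (1 / a)) powr (1 / p)"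
      using assms False by (intro powr_mono2 measure_noise_tail_le) auto
    also have "\<dots> = s powr r"
      by (simp add: powr_powr r_def)
    finally have "ennreal (measure sample {z \<in> space sample. \<bar>noise a z\<bar> > s} powr (1 / p)) \<le> ennreal (s powr r)"
      by (rule ennreal_leI)
    then show ?thesis
      using False by (auto simp: indicator_def intro: add_increasing)
  qed
  have "((\<lambda>s. s powr r) has_integral - (1 powr (r + 1)) / (r + 1)) {1::real..}"
    by (rule has_integral_powr_to_inf) (use r in auto)
  from nn_integral_has_integral_lebesgue[OF _ this]
  have tail: "(\<integral>\<^sup>+ s. ennreal (indicator {1..} s * s powr r) \<partial>lborel) < \<infinity>"
    by simp
  have "(\<integral>\<^sup>+ s\<in>{0..}. ennreal (measure sample {z \<in> space sample. \<bar>noise a z\<bar> > s} powr (1 / p)) \<partial>lborel)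
      \<le> (\<integral>\<^sup>+ s. indicator {0..<1} s + ennreal (indicator {1..} s * s powr r) \<partial>lborel)"
    by (intro nn_integral_mono bound)
  also have "\<dots> = (\<integral>\<^sup>+ s. indicator {0..<1::real} s \<partial>lborel)
      + (\<integral>\<^sup>+ s. ennreal (indicator {1..} s * s powr r) \<partial>lborel)"
    by (rule nn_integral_add) measurable
  also have "\<dots> < \<infinity>"
    using tail by (simp add: ennreal_add_less_top)
  finally show ?thesis .
qed

section \<open>Balancing the exponents\<close>

text \<open>Here \<open>b = 1 / \<gamma>\<close>, the noise exponent is \<open>a = (1 - b) / p\<close>, and \<open>b + a (1 - b)\<close> is the growth exponent of
  the multiplier process. The gain over \<open>b\<close> is \<open>a (1 - b)\<close>; the gain over \<open>1 / p\<close> is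
  \<open>b (1 - (2 - b) / p)\<close>, which is positive because \<open>p \<ge> 2\<close>.\<close>

lemma exponent_gain:
  fixes b p :: real
  assumes "0 < b" "b < 1" "2 \<le> p"
  shows "max b (1 / p) < b + (1 - b) / p * (1 - b)"
proof -
  have "0 < b * (1 - (2 - b) / p)"
    using assms by (intro mult_pos_pos) (auto simp: field_simps)
  also have "b * (1 - (2 - b) / p) = b + (1 - b) / p * (1 - b) - 1 / p"
    using assms by (simp add: field_simps)
  finally show ?thesis
    using assms by (auto intro!: mult_pos_pos divide_pos_pos)
qed

text \<open>The modulus of the noise determines the design point: it exceeds \<open>2 powr a\<close> exactly when the point
  lies to the left of \<open>1 / 2\<close>. Independence would make this event of probability \<open>1 / 2\<close> independent
  of itself.\<close>

lemma not_indep_var_noise: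
  fixes k :: 'i
  assumes "0 < a"
  defines "M \<equiv> \<Pi>\<^sub>M i\<in>(UNIV :: 'i set). sample"
  shows "\<not> prob_space.indep_var M borel (\<lambda>w. noise a (w k)) borel (\<lambda>w. fst (w k))"
proof
  interpret prob_space M
    unfolding M_def by (intro prob_space_PiM prob_space_sample)
  assume ind: "indep_var borel (\<lambda>w. noise a (w k)) borel (\<lambda>w. fst (w k))"
  define E where "E = (\<lambda>w. fst (w k)) -` {..<1 / 2} \<inter> space M"
  have iff: "2 powr a < \<bar>noise a (w k)\<bar> \<longleftrightarrow> fst (w k) < 1 / 2" if "w \<in> space M" for w
  proof -
    have w: "w k \<in> space sample"
      using that by (auto simp: M_def space_PiM)
    then have pos: "0 < fst (w k)"
      by (auto simp: space_sample)
    have two: "2 powr a = (1 / 2) powr - a"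
      by (simp add: powr_minus powr_divide)
    show ?thesis
      unfolding abs_noise[OF w] two
      using powr_less_mono2_neg[of "- a" "fst (w k)" "1 / 2"] powr_mono2'[of "- a" "1 / 2" "fst (w k)"]
        assms(1) pos
      by (cases "fst (w k) < 1 / 2") auto
  qed
  have "(\<lambda>w. (noise a (w k), fst (w k))) -` ({y. 2 powr a < \<bar>y\<bar>} \<times> {..<1 / 2}) \<inter> space M = E"
    "(\<lambda>w. noise a (w k)) -` {y. 2 powr a < \<bar>y\<bar>} \<inter> space M = E"
    using iff by (auto simp: E_def)
  moreover have "prob ((\<lambda>w. (noise a (w k), fst (w k))) -` ({y. 2 powr a < \<bar>y\<bar>} \<times> {..<1 / 2}) \<inter> space M)
      = prob ((\<lambda>w. noise a (w k)) -` {y. 2 powr a < \<bar>y\<bar>} \<inter> space M)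
        * prob ((\<lambda>w. fst (w k)) -` {..<1 / 2} \<inter> space M)"
    by (rule indep_varD[OF ind]) auto
  ultimately have "prob E = prob E * prob E"
    by (simp add: E_def)
  moreover have "prob E = 1 / 2"
  proof -
    have [measurable]: "(\<lambda>w. w k) \<in> M \<rightarrow>\<^sub>M sample"
      unfolding M_def by simp
    have "prob E = (\<integral>w. indicator E w \<partial>M)"
      by (simp add: E_def)
    also have "\<dots> = (\<integral>w. indicator {..<1 / 2} (fst (w k)) \<partial>M)"
      by (intro Bochner_Integration.integral_cong) (auto simp: E_def indicator_def)
    also have "\<dots> = (\<integral>z. indicator {..<1 / 2} (fst z) \<partial>sample)"
      unfolding M_def by (rule integral_PiM_coordinate(1)[OF prob_space_sample]) measurable
    also have "\<dots> = measure lborel ({..<1 / 2} \<inter> {0<..<1::real})"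
      by (rule integral_indicator_fst_sample) simp
    also have "{..<1 / 2} \<inter> {0<..<1::real} = {0<..<1 / 2}"
      by auto
    finally show ?thesis
      by simp
  qed
  ultimately show False
    by simp
qed

theorem proposition1:
  shows "\<exists>(C::real) (c::real \<Rightarrow> real). C > 0 \<and> (\<forall>p. c p > 0) \<and>
    (\<forall>(\<delta>::real) (\<gamma>::real) (p::real).
      0 < \<delta> \<and> \<delta> < 1 / 2 \<and>
      2 < \<gamma> \<and> \<gamma> < 1 + 1 / (2 * \<delta>) \<and>
      2 \<le> p \<and> p < min (4 / \<delta>) (2 * \<gamma> / (1 + \<gamma> * \<delta>)) \<longrightarrow>
      (\<exists>(M::(nat \<Rightarrow> real \<times> real \<times> real) measure)
         (X::nat \<Rightarrow> (nat \<Rightarrow> real \<times> real \<times> real) \<Rightarrow> real)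
         (\<xi>::nat \<Rightarrow> (nat \<Rightarrow> real \<times> real \<times> real) \<Rightarrow> real)
         (\<epsilon>::nat \<Rightarrow> (nat \<Rightarrow> real \<times> real \<times> real) \<Rightarrow> real)
         (\<beta>::real) (\<omega>::nat \<Rightarrow> real).
        prob_space M \<and>
        iid_sequence M borel (\<lambda>i w. (X i w, \<xi> i w)) \<and>
        rademacher_sequence M \<epsilon> \<and>
        indep_pair M
          (Pi\<^sub>M UNIV (\<lambda>_. borel)) (\<lambda>w. \<lambda>i. \<epsilon> i w)
          (Pi\<^sub>M UNIV (\<lambda>_. borel)) (\<lambda>w. \<lambda>i. (X i w, \<xi> i w)) \<and>
        (\<forall>i. \<not> prob_space.indep_var M borel (\<xi> i) borel (X i)) \<and>
        cond_mean_zero M (\<xi> 0) (X 0) \<and>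
        lorentz_norm_p1 M p (\<xi> 0) < \<infinity> \<and>
        \<beta> > 0 \<and>
        (\<forall>n\<ge>1. \<omega> n \<ge> real n powr \<beta> * real n powr (max (1 / \<gamma>) (1 / p))) \<and>
        (\<forall>n\<ge>1. \<exists>F::nat \<Rightarrow> (real \<Rightarrow> real) set.
          (\<forall>k\<in>{1..n}. F k \<subseteq> borel_measurable borel \<and> F n \<subseteq> F k) \<and>
          (\<forall>k\<in>{1..n}.
             sup_process (F k) k \<epsilon> X \<in> borel_measurable M \<and>
             (\<integral>\<^sup>+ w. sup_process (F k) k \<epsilon> X w \<partial>M) \<le> ennreal (C * real k powr (1 / \<gamma>))) \<and>
          sup_process (F n) n \<xi> X \<in> borel_measurable M \<and>
          (\<integral>\<^sup>+ w. sup_process (F n) n \<xi> X w \<partial>M) < \<infinity> \<and>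
          (\<integral>\<^sup>+ w. sup_process (F n) n \<xi> X w \<partial>M) \<ge> ennreal (c p * \<omega> n))))"
proof (rule exI[of _ 1], rule exI[of _ "\<lambda>_. 1 / 2"], intro conjI allI impI, goal_cases)
  case (3 \<delta> \<gamma> p)
  define b where "b = 1 / \<gamma>"
  define a where "a = (1 - b) / p"
  define e where "e = b + a * (1 - b)"
  have b: "0 < b" "b < 1" and p: "2 \<le> p"
    using 3 by (auto simp: b_def field_simps)
  have a: "0 < a" "a < 1" "a * p < 1"
    using b p by (auto simp: a_def field_simps)
  have e: "max b (1 / p) < e"
    using exponent_gain[OF b p] by (simp add: e_def a_def)
  define M where "M = (\<Pi>\<^sub>M i\<in>(UNIV :: nat set). sample)"
  \<comment> \<open>Odd coordinates carry the pairs, even coordinates the Rademacher signs. This makes the two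
    sequences independent by construction.\<close>
  define X where "X i w = fst (w (2 * i + 1))" for i and w :: "nat \<Rightarrow> real \<times> real \<times> real"
  define \<xi> where "\<xi> i w = noise a (w (2 * i + 1))" for i and w :: "nat \<Rightarrow> real \<times> real \<times> real"
  define \<epsilon> where "\<epsilon> i w = fst (snd (w (2 * i)))" for i and w :: "nat \<Rightarrow> real \<times> real \<times> real"
  \<comment> \<open>The window is \<open>(0, n powr (b - 1)]\<close>. Splitting it into \<open>2 n\<close> cells makes each cell catch one of
    the \<open>n\<close> points with probability at most \<open>1 / 2\<close>.\<close>
  define h where "h n = real n powr (b - 1) / real (2 * n)" for n
  define F where "F n = cell_class (h n) (2 * n)" for n
  have M: "prob_space M"
    unfolding M_def by (intro prob_space_PiM prob_space_sample)
  have [measurable]: "(\<lambda>w. w k) \<in> M \<rightarrow>\<^sub>M sample" for k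
    unfolding M_def by simp
  have meas: "X i \<in> borel_measurable M" "\<xi> i \<in> borel_measurable M" "\<epsilon> i \<in> borel_measurable M" for i
    unfolding X_def \<xi>_def \<epsilon>_def by measurable
  have pair: "(\<lambda>z. (fst z, noise a z)) \<in> sample \<rightarrow>\<^sub>M (borel :: (real \<times> real) measure)"
    unfolding borel_prod[symmetric] by measurable
  have odd_inj: "inj (\<lambda>i::nat. 2 * i + 1)" and even_inj: "inj (\<lambda>i::nat. 2 * i)"
    by (auto simp: inj_def)
  have iid: "iid_sequence M borel (\<lambda>i w. (X i w, \<xi> i w))"
    using iid_sequence_PiM_coordinates[OF prob_space_sample odd_inj pair]
    by (simp add: M_def X_def \<xi>_def)
  have rad: "rademacher_sequence M \<epsilon>"
    using rademacher_sequence_sample[OF even_inj]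
    unfolding M_def \<epsilon>_def [abs_def] .
  have disj: "range (\<lambda>i::nat. 2 * i) \<inter> range (\<lambda>i. 2 * i + 1) = {}"
    by (auto, presburger)
  have indep: "indep_pair M
      (Pi\<^sub>M UNIV (\<lambda>_. borel)) (\<lambda>w. \<lambda>i. \<epsilon> i w)
      (Pi\<^sub>M UNIV (\<lambda>_. borel)) (\<lambda>w. \<lambda>i. (X i w, \<xi> i w))"
    using indep_pair_PiM_disjoint_coordinates[OF prob_space_sample disj measurable_sign_sample pair]
    by (simp add: M_def X_def \<xi>_def \<epsilon>_def)
  have not_indep: "\<forall>i. \<not> prob_space.indep_var M borel (\<xi> i) borel (X i)"
    unfolding M_def \<xi>_def [abs_def] X_def [abs_def] by (intro allI not_indep_var_noise a(1))
  have \<xi>_int: "integrable M (\<xi> 0)"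
    unfolding \<xi>_def [abs_def] M_def using integrable_noise[OF a(2)]
    by (subst integral_PiM_coordinate(2)[OF prob_space_sample]) measurable
  have centered: "cond_mean_zero M (\<xi> 0) (X 0)"
  proof (rule cond_mean_zeroI[OF M meas(1) \<xi>_int])
    fix B :: "real set" assume [measurable]: "B \<in> sets borel"
    have "(\<integral>w. indicator B (X 0 w) * \<xi> 0 w \<partial>M) = (\<integral>z. indicator B (fst z) * noise a z \<partial>sample)"
      unfolding X_def \<xi>_def M_def
      by (rule integral_PiM_coordinate(1)[OF prob_space_sample]) measurable
    also have "\<dots> = (\<integral>z. fst (snd z) * (indicator B (fst z) * fst z powr - a) \<partial>sample)"
      by (simp add: noise_def mult_ac)
    also have "\<dots> = 0"
    proof (rule integral_sign_sample)
      show "integrable sample (\<lambda>z. fst (snd z) * (indicator B (fst z) * fst z powr - a))"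
        by (rule Bochner_Integration.integrable_bound[OF integrable_noise[OF a(2)]])
          (auto simp: noise_def indicator_def)
    qed
    finally show "(\<integral>w. indicator B (X 0 w) * \<xi> 0 w \<partial>M) = 0" .
  qed
  have lorentz: "lorentz_norm_p1 M p (\<xi> 0) < \<infinity>"
  proof -
    have "measure M {w \<in> space M. \<bar>\<xi> 0 w\<bar> > s} = measure sample {z \<in> space sample. \<bar>noise a z\<bar> > s}" for s
    proof -
      have "measure (distr M sample (\<lambda>w. w 1)) {z \<in> space sample. \<bar>noise a z\<bar> > s}
          = measure M ((\<lambda>w. w 1) -` {z \<in> space sample. \<bar>noise a z\<bar> > s} \<inter> space M)"
        by (rule measure_distr) measurable
      also have "(\<lambda>w. w 1) -` {z \<in> space sample. \<bar>noise a z\<bar> > s} \<inter> space M = {w \<in> space M. \<bar>\<xi> 0 w\<bar> > s}"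
        by (auto simp: \<xi>_def M_def space_PiM)
      finally show ?thesis
        by (simp add: M_def distr_PiM_coordinate[OF prob_space_sample])
    qed
    then show ?thesis
      using lorentz_norm_p1_noise[of a p] a p by (simp add: lorentz_norm_p1_def)
  qed
  have F_meas: "sup_process (F n) k W X \<in> borel_measurable M" if "\<And>i. W i \<in> borel_measurable M" for n k W
    unfolding F_def using that meas(1)
    by (intro borel_measurable_sup_process countable_finite[OF finite_cell_class] cell_class_measurable)
  have upper: "(\<integral>\<^sup>+ w. sup_process (F n) k \<epsilon> X w \<partial>M) \<le> ennreal (1 * real k powr (1 / \<gamma>))"
    if k: "k \<in> {1..n}" for n k
  proof -
    define t where "t = real n powr (b - 1)"
    have h: "0 \<le> h n" "h n * real (2 * n) = t"
      using k by (auto simp: h_def t_def)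
    have one: "(\<integral>\<^sup>+ w. ennreal (\<bar>\<epsilon> i w\<bar> * indicator {0<..t} (X i w)) \<partial>M) \<le> ennreal t" for i
    proof -
      have "(\<integral>\<^sup>+ w. ennreal (\<bar>\<epsilon> i w\<bar> * indicator {0<..t} (X i w)) \<partial>M)
          = (\<integral>\<^sup>+ w. indicator {0<..t} (fst (w (2 * i + 1))) \<partial>M)"
      proof (rule nn_integral_cong)
        fix w assume "w \<in> space M"
        then have "w (2 * i) \<in> space sample"
          by (auto simp: M_def space_PiM)
        then have "\<bar>\<epsilon> i w\<bar> = 1"
          by (auto simp: \<epsilon>_def space_sample)
        then show "ennreal (\<bar>\<epsilon> i w\<bar> * indicator {0<..t} (X i w)) = indicator {0<..t} (fst (w (2 * i + 1)))"
          by (simp add: X_def indicator_def)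
      qed
      also have "\<dots> = (\<integral>\<^sup>+ z. indicator {0<..t} (fst z) \<partial>sample)"
        unfolding M_def by (rule nn_integral_PiM_coordinate[OF prob_space_sample]) measurable
      also have "\<dots> = emeasure lborel ({0<..t} \<inter> {0<..<1})"
        by (rule integral_indicator_fst_sample) simp
      also have "\<dots> \<le> emeasure lborel {0<..t}"
        by (rule emeasure_mono) auto
      also have "\<dots> = ennreal t"
        by (simp add: t_def)
      finally show ?thesis .
    qed
    have "(\<integral>\<^sup>+ w. sup_process (F n) k \<epsilon> X w \<partial>M)
        \<le> (\<Sum>i<k. \<integral>\<^sup>+ w. ennreal (\<bar>\<epsilon> i w\<bar> * indicator {0<..t} (X i w)) \<partial>M)"
      using nn_integral_sup_process_cell_class_le[OF M h(1) meas(1) meas(3), of "2 * n" k]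
      unfolding F_def h(2) .
    also have "\<dots> \<le> (\<Sum>i<k. ennreal t)"
      by (intro sum_mono one)
    also have "\<dots> = ennreal (real k * t)"
      by (simp add: ennreal_mult t_def ennreal_of_nat_eq_real_of_nat)
    also have "\<dots> \<le> ennreal (1 * real k powr (1 / \<gamma>))"
    proof (rule ennreal_leI)
      \<comment> \<open>The window for \<open>n\<close> is contained in the one for \<open>k\<close> because \<open>k \<le> n\<close> and \<open>b < 1\<close>; hence one class
        serves all \<open>k\<close>.\<close>
      have "real k * t \<le> real k * real k powr (b - 1)"
        unfolding t_def using k b by (intro mult_left_mono powr_mono2') auto
      also have "\<dots> = real k powr b"
        using k by (simp add: powr_diff)
      finally show "real k * t \<le> 1 * real k powr (1 / \<gamma>)"
        by (simp add: b_def)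
    qed
    finally show ?thesis .
  qed
  have finite: "(\<integral>\<^sup>+ w. sup_process (F n) n \<xi> X w \<partial>M) < \<infinity>" for n
  proof -
    have "(\<integral>\<^sup>+ w. ennreal (\<bar>\<xi> i w\<bar> * indicator {0<..h n * real (2 * n)} (X i w)) \<partial>M) < \<infinity>" for i
    proof -
      have "integrable M (\<xi> i)"
        unfolding \<xi>_def [abs_def] M_def using integrable_noise[OF a(2)]
        by (subst integral_PiM_coordinate(2)[OF prob_space_sample]) measurable
      then have "(\<integral>\<^sup>+ w. ennreal (norm (\<xi> i w)) \<partial>M) < \<infinity>"
        by (simp add: integrable_iff_bounded)
      then show ?thesis
        by (rule le_less_trans[rotated]) (auto intro!: nn_integral_mono ennreal_leI simp: indicator_def)
    qed
    then have "(\<Sum>i<n. \<integral>\<^sup>+ w. ennreal (\<bar>\<xi> i w\<bar> * indicator {0<..h n * real (2 * n)} (X i w)) \<partial>M) < \<infinity>"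
      by simp
    moreover have "0 \<le> h n"
      by (simp add: h_def)
    ultimately show ?thesis
      unfolding F_def using nn_integral_sup_process_cell_class_le[OF M _ meas(1) meas(2)]
      by (meson le_less_trans)
  qed
  have lower: "ennreal (1 / 2 * real n powr e) \<le> (\<integral>\<^sup>+ w. sup_process (F n) n \<xi> X w \<partial>M)"
    if n: "1 \<le> n" for n
  proof -
    define t where "t = real n powr (b - 1)"
    have h: "0 \<le> h n" "h n * real (2 * n) = t"
      using n by (auto simp: h_def t_def)
    have t: "0 < t" "t \<le> 1"
      using n b powr_mono[of "b - 1" 0 "real n"] by (auto simp: t_def)
    have sparse: "real n * (\<integral>w. indicator (cell (h n) c) (X 0 w) \<partial>M) \<le> 1 / 2" for c
    proof -
      have "(\<integral>w. indicat_real (cell (h n) c) (X 0 w) \<partial>M) = (\<integral>z. indicator (cell (h n) c) (fst z) \<partial>sample)"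
        unfolding X_def M_def by (rule integral_PiM_coordinate(1)[OF prob_space_sample]) measurable
      also have "\<dots> = measure lborel (cell (h n) c \<inter> {0<..<1})"
        by (rule integral_indicator_fst_sample) simp
      also have "\<dots> \<le> measure lborel (cell (h n) c)"
        using h(1) by (intro measure_mono_fmeasurable) (auto simp: fmeasurable_def cell_def mult_left_mono)
      also have "\<dots> = h n"
        using h(1) by (simp add: cell_def mult_left_mono algebra_simps)
      finally have "real n * (\<integral>w. indicator (cell (h n) c) (X 0 w) \<partial>M) \<le> real n * h n"
        by (rule mult_left_mono) simp
      also have "\<dots> \<le> 1 / 2"
        using h(2) t(2) by (simp add: mult_ac)
      finally show ?thesis .
    qed
    have "1 / 2 * real n powr e = real n / 2 * t powr (1 - a)"
    proof -
      have "e = 1 + (b - 1) * (1 - a)"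
        by (simp add: e_def algebra_simps)
      then show ?thesis
        using n by (simp add: t_def powr_powr powr_add)
    qed
    also have "\<dots> \<le> real n / 2 * (\<integral>w. \<bar>\<xi> 0 w\<bar> * indicator {0<..t} (X 0 w) \<partial>M)"
    proof (rule mult_left_mono)
      have "(\<integral>w. \<bar>\<xi> 0 w\<bar> * indicator {0<..t} (X 0 w) \<partial>M)
          = (\<integral>z. \<bar>noise a z\<bar> * indicator {0<..t} (fst z) \<partial>sample)"
        unfolding X_def \<xi>_def M_def
        by (rule integral_PiM_coordinate(1)[OF prob_space_sample]) measurable
      then show "t powr (1 - a) \<le> (\<integral>w. \<bar>\<xi> 0 w\<bar> * indicator {0<..t} (X 0 w) \<partial>M)"
        using integral_abs_noise_ge[of a t] a t by simp
    qed simp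
    finally have "ennreal (1 / 2 * real n powr e)
        \<le> ennreal (real n / 2 * (\<integral>w. \<bar>\<xi> 0 w\<bar> * indicator {0<..t} (X 0 w) \<partial>M))"
      by (rule ennreal_leI)
    also have "\<dots> \<le> (\<integral>\<^sup>+ w. sup_process (F n) n \<xi> X w \<partial>M)"
      using nn_integral_sup_process_cell_class_ge[OF M h(1) iid \<xi>_int sparse, where K = "2 * n"]
      unfolding F_def h(2) .
    finally show ?thesis .
  qed
  have growth: "real n powr e \<ge> real n powr (e - max b (1 / p)) * real n powr (max (1 / \<gamma>) (1 / p))"
    for n :: nat
    by (simp add: b_def flip: powr_add)
  show ?case
  proof (rule exI[of _ M], rule exI[of _ X], rule exI[of _ \<xi>], rule exI[of _ \<epsilon>],
      rule exI[of _ "e - max b (1 / p)"], rule exI[of _ "\<lambda>n. real n powr e"], intro conjI)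
    show "\<forall>n\<ge>1. \<exists>F::nat \<Rightarrow> (real \<Rightarrow> real) set.
          (\<forall>k\<in>{1..n}. F k \<subseteq> borel_measurable borel \<and> F n \<subseteq> F k) \<and>
          (\<forall>k\<in>{1..n}.
             sup_process (F k) k \<epsilon> X \<in> borel_measurable M \<and>
             (\<integral>\<^sup>+ w. sup_process (F k) k \<epsilon> X w \<partial>M) \<le> ennreal (1 * real k powr (1 / \<gamma>))) \<and>
          sup_process (F n) n \<xi> X \<in> borel_measurable M \<and>
          (\<integral>\<^sup>+ w. sup_process (F n) n \<xi> X w \<partial>M) < \<infinity> \<and>
          (\<integral>\<^sup>+ w. sup_process (F n) n \<xi> X w \<partial>M) \<ge> ennreal (1 / 2 * real n powr e)"
      (is "\<forall>n\<ge>1. ?classes n")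
    proof (intro allI impI)
      fix n :: nat assume n: "1 \<le> n"
      have "F n \<subseteq> borel_measurable borel"
        unfolding F_def by (rule cell_class_measurable)
      then show "?classes n"
        using upper[of _ n] finite[of n] lower[OF n] F_meas[of \<epsilon>] F_meas[of \<xi>] meas(2,3)
        by (intro exI[of _ "\<lambda>_. F n"] conjI ballI) auto
    qed
    show "0 < e - max b (1 / p)"
      using e by simp
    show "\<forall>n\<ge>1. real n powr (e - max b (1 / p)) * real n powr (max (1 / \<gamma>) (1 / p)) \<le> real n powr e"
      using growth by blast
  qed (fact M iid rad indep not_indep centered lorentz)+
qed auto

end
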